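(* Let $\psi$ be a kernel on a set $X$. Then $\psi$ is a measure definite kernel if and only if $\psi$ satisfies the triangular inequality and, moreover, for every finite subset $F$ of $X$, the restriction $\psi|_{F\times F}$ is equal to $\sum_{S\subseteq F}\lambda_S\delta_S$ for some real numbers $\lambda_S\geq 0$, where $\delta_S(x,y)=1$ if $\psi(x,y)>0$ and $S\cap\{x,y\}$ is of cardinality $1$, and $\delta_S(x,y)=0$ otherwise.
   Context: A kernel on a set $X$ is a symmetric map $\psi:X\times X\to[0,\infty)$ with $\psi(x,x)=0$ for all $x$. A kernel $\psi$ on $X$ is measure definite if there exist a measured space $(\mathcal{M},\mathcal{B},\mu)$ and a map $X\to\mathcal{B}$, $x\mapsto S_x$, such that $\psi(x,y)=\mu(S_x\vartriangle S_y)$ for all $x,y\in X$ (symmetric difference). *)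

theory Defs
  imports "HOL-Analysis.Measure_Space"
begin

definition kernel_on :: "'a set \<Rightarrow> ('a \<Rightarrow> 'a \<Rightarrow> real) \<Rightarrow> bool" where
  "kernel_on X \<psi> \<longleftrightarrow>
     (\<forall>x\<in>X. \<forall>y\<in>X. 0 \<le> \<psi> x y) \<and>
     (\<forall>x\<in>X. \<forall>y\<in>X. \<psi> x y = \<psi> y x) \<and>
     (\<forall>x\<in>X. \<psi> x x = 0)"

text \<open>
  HOL cannot quantify existentially over the type of points of the measured space, so that type
  is passed as a parameter. The measure may be infinite (and need not be sigma-finite), and the
  sets \<open>S x\<close> may have infinite measure, so the equation is stated in \<^typ>\<open>ennreal\<close>:
  \<^const>\<open>measure\<close> would read an infinite value as \<open>0\<close>.
\<close>
definition measure_definite ::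
    "'m itself \<Rightarrow> 'a set \<Rightarrow> ('a \<Rightarrow> 'a \<Rightarrow> real) \<Rightarrow> bool" where
  "measure_definite (_ :: 'm itself) X \<psi> \<longleftrightarrow>
     (\<exists>(M :: 'm measure) (S :: 'a \<Rightarrow> 'm set).
        (\<forall>x\<in>X. S x \<in> sets M) \<and>
        (\<forall>x\<in>X. \<forall>y\<in>X. ennreal (\<psi> x y) = emeasure M (sym_diff (S x) (S y))))"

definition triangular_on :: "'a set \<Rightarrow> ('a \<Rightarrow> 'a \<Rightarrow> real) \<Rightarrow> bool" where
  "triangular_on X \<psi> \<longleftrightarrow>
     (\<forall>x\<in>X. \<forall>y\<in>X. \<forall>z\<in>X. \<psi> x z \<le> \<psi> x y + \<psi> y z)"

definition cut_delta :: "('a \<Rightarrow> 'a \<Rightarrow> real) \<Rightarrow> 'a set \<Rightarrow> 'a \<Rightarrow> 'a \<Rightarrow> real" where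
  "cut_delta \<psi> S x y = (if \<psi> x y > 0 \<and> card (S \<inter> {x, y}) = 1 then 1 else 0)"

definition finitely_cut_decomposable :: "'a set \<Rightarrow> ('a \<Rightarrow> 'a \<Rightarrow> real) \<Rightarrow> bool" where
  "finitely_cut_decomposable X \<psi> \<longleftrightarrow>
     (\<forall>F. finite F \<and> F \<subseteq> X \<longrightarrow>
        (\<exists>l :: 'a set \<Rightarrow> real.
           (\<forall>S\<in>Pow F. 0 \<le> l S) \<and>
           (\<forall>x\<in>F. \<forall>y\<in>F. \<psi> x y = (\<Sum>S\<in>Pow F. l S * cut_delta \<psi> S x y))))"

end

theory Submission
  imports Defs "HOL-Analysis.Analysis"
begin

text \<open>
  Suppose first that \<open>\<psi> x y = \<mu> (S\<^sub>x \<triangle> S\<^sub>y)\<close>. The triangle inequality is subadditivity of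
  \<open>\<mu>\<close>. For finite \<open>F\<close>, the sets \<open>S\<^sub>x\<close> with \<open>x \<in> F\<close> cut the space into atoms indexed by the
  subsets of \<open>F\<close>, and \<open>S\<^sub>x \<triangle> S\<^sub>y\<close> is the disjoint union of the atoms whose index separates \<open>x\<close>
  from \<open>y\<close>; the weight of an index is the measure of its atom (lemma
  \<open>measure_definite_imp_finitely_cut_decomposable\<close>).

  Conversely, the triangle inequality allows the points at distance \<open>0\<close> to be identified. On a
  transversal \<open>Y\<close> of this relation all distinct points have positive distance, so that the finite
  decompositions are honest combinations of cut pseudometrics. A decomposition over \<open>F\<close> is a
  finite combination of point masses on the space of cuts, encoded as subsets of the type of
  points, for which the set \<open>sep x y\<close> of those cuts that separate \<open>x\<close> from \<open>y\<close> has mass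
  \<open>\<psi> x y\<close> when \<open>x, y \<in> F\<close>.
  A cluster point of these masses as \<open>F\<close> grows, which exists because \<open>[0, \<infinity>]\<close> to an arbitrary
  power is compact, is a finitely additive set function \<open>m\<close> with \<open>m (sep x y) = \<psi> x y\<close> for all
  \<open>x, y \<in> Y\<close> (lemma \<open>finitely_additive_cut_content\<close>). On the ring of those cylinder sets over
  finite bases that are covered by finitely many sets \<open>sep x y\<close> with \<open>x, y \<in> Y\<close>, the function \<open>m\<close> is finite. A decreasing
  sequence of nonempty cylinder sets has a common point, again by Tychonoff's theorem (lemma
  \<open>cylinder_sequence_Inter_nonempty\<close>), so that \<open>m\<close> is continuous at the empty set, and
  Caratheodory's theorem extends it to a measure (lemma \<open>cut_measure_exists\<close>). With a base point
  \<open>z\<close>, the sets \<open>S\<^sub>x = sep x z\<close> satisfy \<open>S\<^sub>x \<triangle> S\<^sub>y = sep x y\<close>, which makes \<open>\<psi>\<close> measure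
  definite.
\<close>

section \<open>Measure definite kernels decompose into cuts\<close>

lemma measure_definite_imp_triangular_on:
  assumes "kernel_on X \<psi>" and "measure_definite TYPE('m) X \<psi>"
  shows "triangular_on X \<psi>"
  unfolding triangular_on_def
proof (intro ballI)
  fix x y z assume x: "x \<in> X" and y: "y \<in> X" and z: "z \<in> X"
  obtain M :: "'m measure" and S where S: "\<And>x. x \<in> X \<Longrightarrow> S x \<in> sets M"
    and \<psi>: "\<And>x y. x \<in> X \<Longrightarrow> y \<in> X \<Longrightarrow> ennreal (\<psi> x y) = emeasure M (sym_diff (S x) (S y))"
    using assms(2) unfolding measure_definite_def by blast
  have nonneg: "\<And>x y. x \<in> X \<Longrightarrow> y \<in> X \<Longrightarrow> 0 \<le> \<psi> x y"
    using assms(1) unfolding kernel_on_def by blast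
  have "emeasure M (sym_diff (S x) (S z))
      \<le> emeasure M (sym_diff (S x) (S y) \<union> sym_diff (S y) (S z))"
    using S x y z by (intro emeasure_mono) auto
  also have "\<dots> \<le> emeasure M (sym_diff (S x) (S y)) + emeasure M (sym_diff (S y) (S z))"
    using S x y z by (intro emeasure_subadditive) auto
  finally have "ennreal (\<psi> x z) \<le> ennreal (\<psi> x y + \<psi> y z)"
    using x y z by (simp add: \<psi> ennreal_plus nonneg)
  moreover have "0 \<le> \<psi> x y + \<psi> y z"
    using nonneg x y z by simp
  ultimately show "\<psi> x z \<le> \<psi> x y + \<psi> y z"
    using ennreal_le_iff by blast
qed

lemma card_Int_pair_eq_1_iff:
  assumes "x \<noteq> y"
  shows "card (S \<inter> {x, y}) = 1 \<longleftrightarrow> (x \<in> S) \<noteq> (y \<in> S)"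
  using assms by (cases "x \<in> S"; cases "y \<in> S") (auto simp: Int_insert_right)

lemma measure_definite_imp_finitely_cut_decomposable:
  assumes kernel: "kernel_on X \<psi>" and "measure_definite TYPE('m) X \<psi>"
  shows "finitely_cut_decomposable X \<psi>"
  unfolding finitely_cut_decomposable_def
proof (intro allI impI)
  fix F assume "finite F \<and> F \<subseteq> X"
  then have F: "finite F" "F \<subseteq> X" by auto
  obtain M :: "'m measure" and T where T: "\<And>x. x \<in> X \<Longrightarrow> T x \<in> sets M"
    and \<psi>: "\<And>x y. x \<in> X \<Longrightarrow> y \<in> X \<Longrightarrow> ennreal (\<psi> x y) = emeasure M (sym_diff (T x) (T y))"
    using assms(2) unfolding measure_definite_def by blast
  \<comment> \<open>The atoms of index \<open>{}\<close> and \<open>F\<close> may have infinite measure, which \<open>measure\<close> reads as \<open>0\<close>;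
    this is harmless, since these two indices separate no points of \<open>F\<close>.\<close>
  define atom where "atom S = {p \<in> space M. \<forall>x\<in>F. p \<in> T x \<longleftrightarrow> x \<in> S}" for S
  have TF: "\<And>x. x \<in> F \<Longrightarrow> T x \<in> sets M"
    using T F by blast
  have atom_sets: "atom S \<in> sets M" for S
    unfolding atom_def
  proof (intro sets.sets_Collect_finite_All F(1))
    fix x assume "x \<in> F"
    then have "{p \<in> space M. (p \<in> T x) = (x \<in> S)} = (if x \<in> S then T x else space M - T x)"
      using TF[THEN sets.sets_into_space] by auto
    then show "{p \<in> space M. (p \<in> T x) = (x \<in> S)} \<in> sets M"
      using TF[OF \<open>x \<in> F\<close>] by simp
  qed
  have kernel_F: "0 \<le> \<psi> x y" "\<psi> x x = 0" if "x \<in> F" "y \<in> F" for x y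
    using kernel F that unfolding kernel_on_def by blast+
  have decomp: "\<psi> x y = (\<Sum>S\<in>Pow F. measure M (atom S) * cut_delta \<psi> S x y)"
    if xy: "x \<in> F" "y \<in> F" for x y
  proof (cases "\<psi> x y > 0")
    case False
    then have "\<psi> x y = 0"
      using kernel_F xy by force
    then show ?thesis
      by (simp add: cut_delta_def)
  next
    case True
    then have "x \<noteq> y"
      using kernel_F xy by force
    define C where "C = {S \<in> Pow F. (x \<in> S) \<noteq> (y \<in> S)}"
    have C: "finite C" "C \<subseteq> Pow F"
      using F by (auto simp: C_def)
    have Un: "sym_diff (T x) (T y) = (\<Union>S\<in>C. atom S)"
    proof
      show "sym_diff (T x) (T y) \<subseteq> (\<Union>S\<in>C. atom S)"
      proof
        fix p assume p: "p \<in> sym_diff (T x) (T y)"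
        moreover have "p \<in> space M"
          using p TF[THEN sets.sets_into_space] xy by blast
        ultimately have "{a \<in> F. p \<in> T a} \<in> C" "p \<in> atom {a \<in> F. p \<in> T a}"
          using xy unfolding C_def atom_def by auto
        then show "p \<in> (\<Union>S\<in>C. atom S)" by blast
      qed
      show "(\<Union>S\<in>C. atom S) \<subseteq> sym_diff (T x) (T y)"
        using xy unfolding C_def atom_def by auto
    qed
    have "disjoint_family_on atom C"
      unfolding disjoint_family_on_def C_def atom_def by blast
    then have sum: "(\<Sum>S\<in>C. emeasure M (atom S)) = ennreal (\<psi> x y)"
      using sum_emeasure[of atom C M] C atom_sets Un \<psi> xy F by (auto simp: subset_iff)
    have fin: "emeasure M (atom S) = ennreal (measure M (atom S))" if "S \<in> C" for S
    proof -
      have "emeasure M (atom S) \<le> (\<Sum>S\<in>C. emeasure M (atom S))"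
        using C that by (intro member_le_sum) auto
      then have "emeasure M (atom S) \<noteq> \<infinity>"
        unfolding sum by (auto simp: top_unique)
      then show ?thesis
        by (simp add: emeasure_eq_ennreal_measure)
    qed
    have "ennreal (\<psi> x y) = (\<Sum>S\<in>C. ennreal (measure M (atom S)))"
      unfolding sum[symmetric] by (intro sum.cong refl fin)
    then have "ennreal (\<psi> x y) = ennreal (\<Sum>S\<in>C. measure M (atom S))"
      by (simp add: sum_ennreal)
    then have "\<psi> x y = (\<Sum>S\<in>C. measure M (atom S))"
      using True by (simp add: sum_nonneg)
    also have "\<dots> = (\<Sum>S\<in>Pow F. if (x \<in> S) \<noteq> (y \<in> S) then measure M (atom S) else 0)"
      unfolding C_def using F by (subst sum.inter_filter) auto
    also have "\<dots> = (\<Sum>S\<in>Pow F. measure M (atom S) * cut_delta \<psi> S x y)"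
      using True card_Int_pair_eq_1_iff[OF \<open>x \<noteq> y\<close>]
      by (intro sum.cong) (auto simp: cut_delta_def)
    finally show ?thesis .
  qed
  show "\<exists>l. (\<forall>S\<in>Pow F. 0 \<le> l S) \<and>
      (\<forall>x\<in>F. \<forall>y\<in>F. \<psi> x y = (\<Sum>S\<in>Pow F. l S * cut_delta \<psi> S x y))"
    using decomp by (intro exI[of _ "\<lambda>S. measure M (atom S)"]) simp
qed

section \<open>Cluster points in powers of a compact space\<close>

text \<open>Tychonoff's theorem in filter form: the finer filter \<open>G\<close>, along which all coordinates
  converge, plays the role of a convergent subnet.\<close>
lemma fun_filter_cluster_point:
  fixes F :: "('a \<Rightarrow> 'b::topological_space) filter"
  assumes "compact (UNIV :: 'b set)" and "F \<noteq> bot"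
  obtains f G where "G \<noteq> bot" "G \<le> F" "\<And>i. ((\<lambda>g. g i) \<longlongrightarrow> f i) G"
proof -
  have "compactin (product_topology (\<lambda>_::'a. euclidean :: 'b topology) UNIV) (PiE UNIV (\<lambda>_. UNIV))"
    unfolding compactin_PiE using assms(1) by simp
  then have "compact (UNIV :: ('a \<Rightarrow> 'b) set)"
    by (simp add: euclidean_product_topology)
  then obtain f where f: "inf (nhds f) F \<noteq> bot"
    unfolding compact_filter using assms(2) by auto
  have "((\<lambda>g. g i) \<longlongrightarrow> f i) (inf (nhds f) F)" for i
  proof -
    have "((\<lambda>g. g i) \<longlongrightarrow> f i) (nhds f)"
    proof (rule topological_tendstoI)
      fix U :: "'b set" assume "open U" "f i \<in> U"
      then have "open ((\<lambda>g :: 'a \<Rightarrow> 'b. g i) -` U)"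
        by (intro open_vimage continuous_on_product_coordinates)
      then show "\<forall>\<^sub>F g in nhds f. g i \<in> U"
        using \<open>f i \<in> U\<close> unfolding eventually_nhds by (intro exI[of _ "(\<lambda>g. g i) -` U"]) auto
    qed
    then show ?thesis
      by (rule tendsto_mono[rotated]) simp
  qed
  then show thesis
    using f by (intro that[of "inf (nhds f) F" f]) auto
qed

section \<open>The space of cuts\<close>

text \<open>The cuts that separate two given points; a cut is encoded by either of its two sides.\<close>
definition sep :: "'a \<Rightarrow> 'a \<Rightarrow> 'a set set" where
  "sep x y = {S. (x \<in> S) \<noteq> (y \<in> S)}"

lemma sym_diff_sep: "sym_diff (sep x z) (sep y z) = sep x y"
  by (auto simp: sep_def)

text \<open>A set of cuts is a cylinder over \<open>G\<close> if membership of a cut depends only on its trace on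
  \<open>G\<close>.\<close>
definition cylinder :: "'a set \<Rightarrow> 'a set set \<Rightarrow> bool" where
  "cylinder G A \<longleftrightarrow> (\<forall>S T. S \<inter> G = T \<inter> G \<longrightarrow> S \<in> A \<longrightarrow> T \<in> A)"

lemma cylinderD: "cylinder G A \<Longrightarrow> S \<inter> G = T \<inter> G \<Longrightarrow> S \<in> A \<Longrightarrow> T \<in> A"
  unfolding cylinder_def by blast

lemma cylinder_mono:
  assumes "cylinder G A" and "G \<subseteq> H"
  shows "cylinder H A"
  unfolding cylinder_def
proof (intro allI impI)
  fix S T assume eq: "S \<inter> H = T \<inter> H" and "S \<in> A"
  have "S \<inter> G = (S \<inter> H) \<inter> G" "T \<inter> G = (T \<inter> H) \<inter> G"
    using \<open>G \<subseteq> H\<close> by auto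
  then show "T \<in> A"
    using eq \<open>S \<in> A\<close> by (intro cylinderD[OF assms(1), of S T]) simp_all
qed

lemma cylinder_Un: "cylinder G A \<Longrightarrow> cylinder G B \<Longrightarrow> cylinder G (A \<union> B)"
  unfolding cylinder_def by (meson Un_iff)

lemma cylinder_Diff: "cylinder G A \<Longrightarrow> cylinder G B \<Longrightarrow> cylinder G (A - B)"
  unfolding cylinder_def by (metis (no_types) Diff_iff)

lemma cylinder_sep: "x \<in> G \<Longrightarrow> y \<in> G \<Longrightarrow> cylinder G (sep x y)"
  unfolding cylinder_def sep_def by (auto simp: set_eq_iff)

text \<open>Compactness of the space of cuts, in the form in which it yields countable additivity.\<close>
lemma cylinder_sequence_Inter_nonempty:
  fixes A :: "nat \<Rightarrow> 'a set set"
  assumes cyl: "\<And>i. \<exists>G. finite G \<and> cylinder G (A i)"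
    and "decseq A" and nonempty: "\<And>i. A i \<noteq> {}"
  shows "(\<Inter>i. A i) \<noteq> {}"
proof -
  have "\<forall>i. \<exists>S. S \<in> A i"
    using nonempty by blast
  then obtain S where S: "\<And>i. S i \<in> A i"
    by metis
  \<comment> \<open>The common point is a cluster point of the characteristic functions of the \<open>S n\<close>.\<close>
  let ?F = "filtermap (\<lambda>n x. x \<in> S n) sequentially"
  have "compact (UNIV :: bool set)" "?F \<noteq> bot"
    by (simp_all add: finite_imp_compact filtermap_bot_iff)
  then obtain f G where G: "G \<noteq> bot" "G \<le> ?F" and lim: "\<And>x. ((\<lambda>g. g x) \<longlongrightarrow> f x) G"
    by (rule fun_filter_cluster_point) blast
  have "Collect f \<in> A i" for i
  proof -
    obtain H where H: "finite H" "cylinder H (A i)"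
      using cyl by blast
    have "\<forall>\<^sub>F g in G. \<forall>x\<in>H. g x = f x"
      using H(1) lim by (simp add: eventually_ball_finite_distrib tendsto_discrete)
    moreover have "\<forall>\<^sub>F g in ?F. Collect g \<in> A i"
      unfolding eventually_filtermap eventually_sequentially
      using S decseqD[OF \<open>decseq A\<close>] by (intro exI[of _ i]) (auto simp: subset_iff)
    then have "\<forall>\<^sub>F g in G. Collect g \<in> A i"
      using G(2) by (rule filter_leD[rotated])
    ultimately have "\<forall>\<^sub>F g in G. Collect f \<in> A i"
      by eventually_elim (rule cylinderD[OF H(2)], auto)
    then show ?thesis
      using G(1) by simp
  qed
  then show ?thesis by blast
qed

section \<open>From finite cut decompositions to a measure on cuts\<close>

text \<open>The content is defined and additive on all sets of cuts, but may be infinite on some of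
  them.\<close>
lemma finitely_additive_cut_content:
  fixes \<psi> :: "'a \<Rightarrow> 'a \<Rightarrow> real"
  assumes decomp: "\<And>F. finite F \<Longrightarrow> F \<subseteq> X \<Longrightarrow>
    \<exists>l. (\<forall>S\<in>Pow F. 0 \<le> l S) \<and>
      (\<forall>x\<in>F. \<forall>y\<in>F. \<psi> x y = (\<Sum>S\<in>Pow F. l S * of_bool ((x \<in> S) \<noteq> (y \<in> S))))"
  obtains m :: "'a set set \<Rightarrow> ennreal" where
    "m {} = 0" "\<And>A B. A \<inter> B = {} \<Longrightarrow> m (A \<union> B) = m A + m B"
    "\<And>x y. x \<in> X \<Longrightarrow> y \<in> X \<Longrightarrow> m (sep x y) = ennreal (\<psi> x y)"
proof -
  obtain l where l: "\<And>F S. finite F \<Longrightarrow> F \<subseteq> X \<Longrightarrow> S \<in> Pow F \<Longrightarrow> 0 \<le> l F S"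
    and \<psi>: "\<And>F x y. finite F \<Longrightarrow> F \<subseteq> X \<Longrightarrow> x \<in> F \<Longrightarrow> y \<in> F \<Longrightarrow>
      \<psi> x y = (\<Sum>S\<in>Pow F. l F S * of_bool ((x \<in> S) \<noteq> (y \<in> S)))"
    using decomp by metis
  define mass :: "'a set \<Rightarrow> 'a set set \<Rightarrow> ennreal" where
    "mass F A = (\<Sum>S\<in>Pow F. ennreal (l F S * of_bool (S \<in> A)))" for F A
  have mass_empty: "mass F {} = 0" for F
    by (simp add: mass_def)
  have mass_Un: "mass F (A \<union> B) = mass F A + mass F B" if "A \<inter> B = {}" for F A B
    unfolding mass_def sum.distrib[symmetric] using that by (intro sum.cong) auto
  have mass_sep: "mass F (sep x y) = ennreal (\<psi> x y)"
    if "finite F" "F \<subseteq> X" "x \<in> F" "y \<in> F" for F x y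
    using that l unfolding mass_def \<psi>[OF that] by (subst sum_ennreal) (auto simp: sep_def)
  let ?F = "filtermap mass (finite_subsets_at_top X)"
  have "compact (UNIV :: ennreal set)" "?F \<noteq> bot"
    by (simp_all add: compact_UNIV filtermap_bot_iff)
  then obtain m G where G: "G \<noteq> bot" "G \<le> ?F" and lim: "\<And>A. ((\<lambda>g. g A) \<longlongrightarrow> m A) G"
    by (rule fun_filter_cluster_point) blast
  have ev: "\<forall>\<^sub>F g in G. P g" if "\<forall>\<^sub>F F in finite_subsets_at_top X. P (mass F)" for P
    using G(2) that by (simp add: filter_leD eventually_filtermap)
  show thesis
  proof
    have "\<forall>\<^sub>F g in G. g {} = 0"
      by (rule ev) (simp add: mass_empty)
    then show "m {} = 0"
      by (intro tendsto_unique[OF G(1) lim] tendsto_eventually)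
  next
    fix A B :: "'a set set" assume "A \<inter> B = {}"
    then have "\<forall>\<^sub>F g in G. g (A \<union> B) = g A + g B"
      by (intro ev) (simp add: mass_Un)
    then have "((\<lambda>g. g A + g B) \<longlongrightarrow> m (A \<union> B)) G"
      by (rule Lim_transform_eventually[OF lim])
    moreover have "((\<lambda>g. g A + g B) \<longlongrightarrow> m A + m B) G"
      by (intro tendsto_add lim)
    ultimately show "m (A \<union> B) = m A + m B"
      by (rule tendsto_unique[OF G(1)])
  next
    fix x y assume "x \<in> X" "y \<in> X"
    then have "\<forall>\<^sub>F g in G. g (sep x y) = ennreal (\<psi> x y)"
      by (intro ev) (auto simp: eventually_finite_subsets_at_top mass_sep
          intro!: exI[of _ "{x, y}"])
    then show "m (sep x y) = ennreal (\<psi> x y)"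
      by (intro tendsto_unique[OF G(1) lim] tendsto_eventually)
  qed
qed

text \<open>The cylinders over finite subsets \<open>G\<close> of \<open>X\<close> all of whose cuts separate two points of
  \<open>G\<close>. The covering condition is what keeps the content finite on them.\<close>
definition cut_ring :: "'a set \<Rightarrow> 'a set set set" where
  "cut_ring X = {A. \<exists>G. finite G \<and> G \<subseteq> X \<and> cylinder G A \<and> A \<subseteq> (\<Union>(x, y)\<in>G \<times> G. sep x y)}"

lemma sep_in_cut_ring: "x \<in> X \<Longrightarrow> y \<in> X \<Longrightarrow> sep x y \<in> cut_ring X"
  unfolding cut_ring_def by (auto intro!: exI[of _ "{x, y}"] cylinder_sep)

lemma ring_of_sets_cut_ring: "ring_of_sets UNIV (cut_ring X)"
  unfolding ring_of_sets_iff
proof (intro conjI ballI)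
  show "{} \<in> cut_ring X"
    unfolding cut_ring_def by (auto simp: cylinder_def)
  fix A B assume "A \<in> cut_ring X" "B \<in> cut_ring X"
  then obtain G H where G: "finite G" "G \<subseteq> X" "cylinder G A" "A \<subseteq> (\<Union>(x, y)\<in>G \<times> G. sep x y)"
    and H: "finite H" "H \<subseteq> X" "cylinder H B" "B \<subseteq> (\<Union>(x, y)\<in>H \<times> H. sep x y)"
    unfolding cut_ring_def by blast
  have cyl: "cylinder (G \<union> H) A" "cylinder (G \<union> H) B"
    using G(3) H(3) by (auto elim: cylinder_mono)
  have sub: "A \<subseteq> (\<Union>(x, y)\<in>(G \<union> H) \<times> (G \<union> H). sep x y)"
    "B \<subseteq> (\<Union>(x, y)\<in>(G \<union> H) \<times> (G \<union> H). sep x y)"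
    using G(4) H(4) by (auto dest!: subsetD)
  have fin: "finite (G \<union> H)" "G \<union> H \<subseteq> X"
    using G H by auto
  show "A \<union> B \<in> cut_ring X"
    unfolding cut_ring_def mem_Collect_eq
    by (intro exI[of _ "G \<union> H"] conjI fin cylinder_Un[OF cyl] Un_least sub)
  show "A - B \<in> cut_ring X"
    unfolding cut_ring_def mem_Collect_eq
    by (intro exI[of _ "G \<union> H"] conjI fin cylinder_Diff[OF cyl] order_trans[OF Diff_subset sub(1)])
qed simp

lemma cut_measure_exists:
  fixes \<psi> :: "'a \<Rightarrow> 'a \<Rightarrow> real"
  assumes "\<And>F. finite F \<Longrightarrow> F \<subseteq> X \<Longrightarrow>
    \<exists>l. (\<forall>S\<in>Pow F. 0 \<le> l S) \<and>
      (\<forall>x\<in>F. \<forall>y\<in>F. \<psi> x y = (\<Sum>S\<in>Pow F. l S * of_bool ((x \<in> S) \<noteq> (y \<in> S))))"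
  obtains M :: "'a set measure" where
    "\<And>x y. x \<in> X \<Longrightarrow> y \<in> X \<Longrightarrow> sep x y \<in> sets M"
    "\<And>x y. x \<in> X \<Longrightarrow> y \<in> X \<Longrightarrow> emeasure M (sep x y) = ennreal (\<psi> x y)"
proof -
  obtain m :: "'a set set \<Rightarrow> ennreal" where m_empty: "m {} = 0"
    and m_Un: "\<And>A B. A \<inter> B = {} \<Longrightarrow> m (A \<union> B) = m A + m B"
    and m_sep: "\<And>x y. x \<in> X \<Longrightarrow> y \<in> X \<Longrightarrow> m (sep x y) = ennreal (\<psi> x y)"
    using finitely_additive_cut_content[OF assms] by blast
  have m_mono: "m A \<le> m B" if "A \<subseteq> B" for A B
    using m_Un[of A "B - A"] that by (simp add: Un_absorb1)
  have m_subadd: "m (A \<union> B) \<le> m A + m B" for A B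
  proof -
    have "m (A \<union> B) = m A + m (B - A)"
      using m_Un[of A "B - A"] by simp
    also have "\<dots> \<le> m A + m B"
      by (intro add_left_mono m_mono) auto
    finally show ?thesis .
  qed
  have m_UN: "m (\<Union>i\<in>I. B i) < top" if "finite I" "\<And>i. i \<in> I \<Longrightarrow> m (B i) < top"
    for I :: "('a \<times> 'a) set" and B
    using that
  proof (induction I rule: finite_induct)
    case (insert i I)
    then have "m (B i) + m (\<Union>i\<in>I. B i) < top" by simp
    then show ?case
      using m_subadd[of "B i" "\<Union>i\<in>I. B i"] by (simp add: le_less_trans)
  qed (simp add: m_empty)
  interpret ring_of_sets UNIV "cut_ring X"
    by (rule ring_of_sets_cut_ring)
  have "\<exists>\<mu>. (\<forall>A\<in>cut_ring X. \<mu> A = m A) \<and> measure_space UNIV (sigma_sets UNIV (cut_ring X)) \<mu>"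
  proof (rule caratheodory_empty_continuous)
    show "positive (cut_ring X) m"
      using m_empty by (simp add: positive_def)
    show "additive (cut_ring X) m"
      using m_Un by (simp add: additive_def)
  next
    fix A assume "A \<in> cut_ring X"
    then obtain G where G: "finite G" "G \<subseteq> X" "A \<subseteq> (\<Union>(x, y)\<in>G \<times> G. sep x y)"
      unfolding cut_ring_def by blast
    have "m (\<Union>(x, y)\<in>G \<times> G. sep x y) < top"
      using G m_sep by (intro m_UN) (auto simp: subset_iff)
    then show "m A \<noteq> \<infinity>"
      using m_mono[OF G(3)] by (auto simp: top_unique)
  next
    fix A :: "nat \<Rightarrow> 'a set set"
    assume A: "range A \<subseteq> cut_ring X" "decseq A" "(\<Inter>i. A i) = {}"
    have "\<exists>G. finite G \<and> cylinder G (A i)" for i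
      using A(1) unfolding cut_ring_def by blast
    then obtain i where "A i = {}"
      using cylinder_sequence_Inter_nonempty[of A] A by blast
    then have "A n = {}" if "n \<ge> i" for n
      using decseqD[OF A(2) that] by simp
    then have "\<forall>\<^sub>F n in sequentially. m (A n) = 0"
      using m_empty unfolding eventually_sequentially by metis
    then show "(\<lambda>n. m (A n)) \<longlonglongrightarrow> 0"
      by (rule tendsto_eventually)
  qed
  then obtain \<mu> where \<mu>: "\<And>A. A \<in> cut_ring X \<Longrightarrow> \<mu> A = m A"
    and ms: "measure_space UNIV (sigma_sets UNIV (cut_ring X)) \<mu>"
    by blast
  define M where "M = measure_of UNIV (cut_ring X) \<mu>"
  have sets: "A \<in> sets M" if "A \<in> cut_ring X" for A
    using that by (simp add: M_def sigma_sets.Basic)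
  moreover have "emeasure M A = \<mu> A" if "A \<in> cut_ring X" for A
  proof (rule emeasure_measure_of[OF M_def])
    have "sets M = sigma_sets UNIV (cut_ring X)"
      by (simp add: M_def)
    then show "positive (sets M) \<mu>" "countably_additive (sets M) \<mu>"
      using ms unfolding measure_space_def by auto
  qed (use that sets in auto)
  ultimately show thesis
    using sep_in_cut_ring[of _ X] \<mu> m_sep by (intro that[of M]) simp_all
qed

section \<open>Kernels that decompose into cuts are measure definite\<close>

lemma cut_decomposable_imp_measure_definite:
  fixes \<psi> :: "'a \<Rightarrow> 'a \<Rightarrow> real"
  assumes kernel: "kernel_on X \<psi>" and triangle: "triangular_on X \<psi>"
    and decomp: "finitely_cut_decomposable X \<psi>"
  shows "measure_definite TYPE('a set) X \<psi>"
proof -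
  have nonneg: "\<And>x y. x \<in> X \<Longrightarrow> y \<in> X \<Longrightarrow> 0 \<le> \<psi> x y"
    and sym: "\<And>x y. x \<in> X \<Longrightarrow> y \<in> X \<Longrightarrow> \<psi> x y = \<psi> y x"
    and refl: "\<And>x. x \<in> X \<Longrightarrow> \<psi> x x = 0"
    using kernel unfolding kernel_on_def by auto
  have tri: "\<And>x y z. x \<in> X \<Longrightarrow> y \<in> X \<Longrightarrow> z \<in> X \<Longrightarrow> \<psi> x z \<le> \<psi> x y + \<psi> y z"
    using triangle unfolding triangular_on_def by blast
  \<comment> \<open>A choice of one representative in each class of points at distance \<open>0\<close>.\<close>
  define r where "r x = (SOME y. y \<in> X \<and> \<psi> x y = 0)" for x
  have r: "r x \<in> X" "\<psi> x (r x) = 0" if "x \<in> X" for x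
    using someI[of "\<lambda>y. y \<in> X \<and> \<psi> x y = 0" x] refl that unfolding r_def by auto
  have \<psi>_cong: "\<psi> x z = \<psi> y z" if "x \<in> X" "y \<in> X" "z \<in> X" "\<psi> x y = 0" for x y z
    using tri[of x y z] tri[of y x z] sym[of x y] that by simp
  have r_eq: "r x = r y" if "x \<in> X" "y \<in> X" "\<psi> x y = 0" for x y
  proof -
    have "z \<in> X \<and> \<psi> x z = 0 \<longleftrightarrow> z \<in> X \<and> \<psi> y z = 0" for z
      using \<psi>_cong[OF that(1,2) _ that(3), of z] by auto
    then show ?thesis by (simp add: r_def)
  qed
  have \<psi>_r: "\<psi> (r x) (r y) = \<psi> x y" if "x \<in> X" "y \<in> X" for x y
  proof -
    have "\<psi> (r x) (r y) = \<psi> x (r y)"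
      using that r by (intro \<psi>_cong[symmetric]) auto
    also have "\<dots> = \<psi> (r y) x"
      using that r by (intro sym)
    also have "\<dots> = \<psi> y x"
      using that r by (intro \<psi>_cong[symmetric]) auto
    also have "\<dots> = \<psi> x y"
      using that by (intro sym)
    finally show ?thesis .
  qed
  have pos: "\<psi> x y > 0" if xy: "x \<in> r ` X" "y \<in> r ` X" "x \<noteq> y" for x y
  proof -
    obtain a b where ab: "a \<in> X" "b \<in> X" "x = r a" "y = r b"
      using xy by blast
    then have "\<psi> a b \<noteq> 0"
      using r_eq xy(3) by blast
    then show ?thesis
      using nonneg[OF ab(1,2)] \<psi>_r[OF ab(1,2)] ab by simp
  qed
  have cut: "\<exists>l. (\<forall>S\<in>Pow F. 0 \<le> l S) \<and>
      (\<forall>x\<in>F. \<forall>y\<in>F. \<psi> x y = (\<Sum>S\<in>Pow F. l S * of_bool ((x \<in> S) \<noteq> (y \<in> S))))"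
    if F: "finite F" "F \<subseteq> r ` X" for F
  proof -
    have FX: "F \<subseteq> X"
      using F(2) r(1) by blast
    then obtain l where l: "\<forall>S\<in>Pow F. 0 \<le> l S"
      "\<forall>x\<in>F. \<forall>y\<in>F. \<psi> x y = (\<Sum>S\<in>Pow F. l S * cut_delta \<psi> S x y)"
      using decomp F(1) unfolding finitely_cut_decomposable_def by blast
    have "cut_delta \<psi> S x y = of_bool ((x \<in> S) \<noteq> (y \<in> S))" if "x \<in> F" "y \<in> F" for S x y
    proof (cases "x = y")
      case True
      then show ?thesis using that FX refl by (auto simp: cut_delta_def)
    next
      case False
      then have "\<psi> x y > 0" using that F(2) pos by blast
      then show ?thesis using card_Int_pair_eq_1_iff[OF False] by (simp add: cut_delta_def)
    qed
    then show ?thesis using l by (intro exI[of _ l]) simp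
  qed
  obtain M :: "'a set measure" where
    M: "\<And>x y. x \<in> r ` X \<Longrightarrow> y \<in> r ` X \<Longrightarrow> sep x y \<in> sets M"
      "\<And>x y. x \<in> r ` X \<Longrightarrow> y \<in> r ` X \<Longrightarrow> emeasure M (sep x y) = ennreal (\<psi> x y)"
    using cut_measure_exists[OF cut] by blast
  show ?thesis
  proof (cases "X = {}")
    case True
    then show ?thesis by (simp add: measure_definite_def)
  next
    case False
    then obtain z where "z \<in> X" by blast
    then show ?thesis
      unfolding measure_definite_def
      by (intro exI[of _ M] exI[of _ "\<lambda>x. sep (r x) (r z)"])
        (simp add: sym_diff_sep M \<psi>_r)
  qed
qed

theorem corollary6p17:
  fixes X :: "'a set" and \<psi> :: "'a \<Rightarrow> 'a \<Rightarrow> real"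
  assumes "kernel_on X \<psi>"
  shows "(measure_definite TYPE('a set) X \<psi> \<longleftrightarrow>
            triangular_on X \<psi> \<and> finitely_cut_decomposable X \<psi>) \<and>
         (measure_definite TYPE('m) X \<psi> \<longrightarrow>
            triangular_on X \<psi> \<and> finitely_cut_decomposable X \<psi>)"
  by (intro conjI iffI impI)
    (blast intro: measure_definite_imp_triangular_on[OF assms]
      measure_definite_imp_finitely_cut_decomposable[OF assms]
      cut_decomposable_imp_measure_definite[OF assms])+

end
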